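(* For all integers $s,m\ge1$, as formal power series, $$\mathcal E_m^{(s)}(z)=\frac{\sum_{j=0}^{s-1}(-1)^j a_{j+1}^{(s,m)}z^j}{\Delta_{s,m}(z)},\qquad \mathcal O_m^{(s)}(z)=\frac{\sum_{j=0}^{s}(-1)^j b_j^{(s,m)}z^j}{\Delta_{s,m}(z)}.$$ Moreover, $$G_m^{(s)}(y)=1+y\bigl(\mathcal O_m^{(s)}(y^2)-m\bigr)+y^2\,\mathcal E_m^{(s)}(y^2).$$
   Context: For integers $d\ge2$ and $s\ge1$ let $$\mathcal P_d^{(s)}=\{x=(x_1,\dots,x_d)\in\mathbb R_{\ge0}^d:\ x_i+x_{i+1}\le s+\delta_i,\ 1\le i\le d-1\},$$ where $\delta_i=0$ for $i$ odd and $\delta_i=1$ for $i$ even. Let $L_d^{(s)}(m):=\#(m\mathcal P_d^{(s)}\cap\mathbb Z^d)$ for $d\ge2$, with the conventions $L_0^{(s)}(m)=1$, $L_1^{(s)}(m)=sm+1$, and let $G_m^{(s)}(y):=\sum_{d\ge0}L_d^{(s)}(m)\,y^d$. For $s,m\ge1$ define matrices indexed by $0\le i,j\le (s+1)m$: $(\mathsf X)_{ij}=1$ if $i+j\le sm$ and $0$ otherwise; $(\mathsf Y)_{ij}=1$ if $i+j\le(s+1)m$ and $0$ otherwise; $\mathsf Z=\mathsf X\mathsf Y$; and let $\mathbf e=(1,\dots,1)^\top\in\mathbb R^{(s+1)m+1}$. The parity-split series are $$\mathcal O_m^{(s)}(z):=\mathbf e^\top(I-z\mathsf Z)^{-1}\mathbf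 e,\qquad \mathcal E_m^{(s)}(z):=\mathbf e^\top(I-z\mathsf Z)^{-1}\mathsf X\,\mathbf e.$$ (They collect the odd-dimensional and even-dimensional counts: $[z^r]\mathcal O_m^{(s)}=L_{2r+1}^{(s)}(m)$ for $r\ge1$, with constant term $(s+1)m+1$, and $[z^r]\mathcal E_m^{(s)}=L_{2r+2}^{(s)}(m)$ for $r\ge0$.) For $0\le j\le s$ put $$a_j^{(s,m)}:=\binom{(s+1-j)m+j+1}{2j},\qquad b_j^{(s,m)}:=\binom{(s+1-j)m+j+1}{2j+1},\qquad \Delta_{s,m}(z):=\sum_{j=0}^{s}(-1)^j a_j^{(s,m)}z^j,$$ where $\binom{n}{k}=0$ for integers $0\le n<k$. *)

theory Defs
  imports
    "Jordan_Normal_Form.Determinant"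
    "HOL-Computational_Algebra.Formal_Power_Series"
begin

text \<open>Vectors carry their dimension at runtime and are indexed from 0, so the coordinate
  \<open>x\<^sub>i\<close> is \<open>vec_index x (i - 1)\<close>.\<close>

definition delta :: "nat \<Rightarrow> nat" where
  "delta i = (if odd i then 0 else 1)"

definition polytope_P :: "nat \<Rightarrow> nat \<Rightarrow> real vec set" where
  "polytope_P s d = {x \<in> carrier_vec d.
     (\<forall>i\<in>{1..d}. 0 \<le> vec_index x (i - 1)) \<and>
     (\<forall>i\<in>{1..d - 1}. vec_index x (i - 1) + vec_index x i \<le> real (s + delta i))}"

definition integer_points :: "nat \<Rightarrow> real vec set" where
  "integer_points d = {x \<in> carrier_vec d. \<forall>i<d. vec_index x i \<in> \<int>}"

definition lattice_count :: "nat \<Rightarrow> nat \<Rightarrow> nat \<Rightarrow> nat" where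
  "lattice_count s d m =
     (if d = 0 then 1
      else if d = 1 then s * m + 1
      else card ((\<lambda>x. real m \<cdot>\<^sub>v x) ` polytope_P s d \<inter> integer_points d))"

definition series_G :: "nat \<Rightarrow> nat \<Rightarrow> real fps" where
  "series_G s m = Abs_fps (\<lambda>d. real (lattice_count s d m))"

definition mat_X :: "nat \<Rightarrow> nat \<Rightarrow> real mat" where
  "mat_X s m = mat ((s + 1) * m + 1) ((s + 1) * m + 1)
     (\<lambda>(i, j). if i + j \<le> s * m then 1 else 0)"

definition mat_Y :: "nat \<Rightarrow> nat \<Rightarrow> real mat" where
  "mat_Y s m = mat ((s + 1) * m + 1) ((s + 1) * m + 1)
     (\<lambda>(i, j). if i + j \<le> (s + 1) * m then 1 else 0)"

definition mat_Z :: "nat \<Rightarrow> nat \<Rightarrow> real mat" where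
  "mat_Z s m = mat_X s m * mat_Y s m"

definition ones_vec :: "nat \<Rightarrow> nat \<Rightarrow> real vec" where
  "ones_vec s m = vec ((s + 1) * m + 1) (\<lambda>_. 1)"

text \<open>The two-sided inverse of a square matrix over a commutative ring; it is unspecified
  for a matrix that is not invertible.\<close>

definition matrix_inverse :: "'a :: comm_ring_1 mat \<Rightarrow> 'a mat" where
  "matrix_inverse A = (THE B.
     B \<in> carrier_mat (dim_row A) (dim_row A) \<and> inverts_mat A B \<and> inverts_mat B A)"

text \<open>The matrix \<open>I - z Z\<close> over the ring of formal power series in \<open>z\<close>; real matrices and
  vectors are embedded through \<open>fps_const\<close>.\<close>

definition pencil :: "nat \<Rightarrow> nat \<Rightarrow> real fps mat" where
  "pencil s m = 1\<^sub>m ((s + 1) * m + 1) - fps_X \<cdot>\<^sub>m map_mat fps_const (mat_Z s m)"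

definition series_O :: "nat \<Rightarrow> nat \<Rightarrow> real fps" where
  "series_O s m =
     map_vec fps_const (ones_vec s m) \<bullet>
       (matrix_inverse (pencil s m) *\<^sub>v map_vec fps_const (ones_vec s m))"

definition series_E :: "nat \<Rightarrow> nat \<Rightarrow> real fps" where
  "series_E s m =
     map_vec fps_const (ones_vec s m) \<bullet>
       (matrix_inverse (pencil s m) *\<^sub>v
         (map_mat fps_const (mat_X s m) *\<^sub>v map_vec fps_const (ones_vec s m)))"

text \<open>In the theorem \<open>j \<le> s\<close>, so the truncated subtraction \<open>s + 1 - j\<close> is exact.\<close>

definition coeff_a :: "nat \<Rightarrow> nat \<Rightarrow> nat \<Rightarrow> nat" where
  "coeff_a s m j = ((s + 1 - j) * m + j + 1) choose (2 * j)"

definition coeff_b :: "nat \<Rightarrow> nat \<Rightarrow> nat \<Rightarrow> nat" where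
  "coeff_b s m j = ((s + 1 - j) * m + j + 1) choose (2 * j + 1)"

definition Delta :: "nat \<Rightarrow> nat \<Rightarrow> real fps" where
  "Delta s m = (\<Sum>j = 0..s. fps_const ((- 1) ^ j * real (coeff_a s m j)) * fps_X ^ j)"

lemma matrix_inverse_eqI:
  assumes "A \<in> carrier_mat n n" "B \<in> carrier_mat n n" "inverts_mat A B" "inverts_mat B A"
  shows "matrix_inverse A = B"
  unfolding matrix_inverse_def
proof (rule the_equality)
  show "B \<in> carrier_mat (dim_row A) (dim_row A) \<and> inverts_mat A B \<and> inverts_mat B A"
    using assms by auto
next
  fix C assume "C \<in> carrier_mat (dim_row A) (dim_row A) \<and> inverts_mat A C \<and> inverts_mat C A"
  then have C: "C \<in> carrier_mat n n" and CA: "C * A = 1\<^sub>m n"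
    using assms(1) unfolding inverts_mat_def by auto
  have AB: "A * B = 1\<^sub>m n" using assms unfolding inverts_mat_def by auto
  have "C = C * (A * B)" using AB C by simp
  also have "\<dots> = (C * A) * B" using assms(1,2) C by (simp add: assoc_mult_mat)
  also have "\<dots> = B" using CA assms(2) by simp
  finally show "C = B" .
qed

text \<open>The matrix \<open>I - z Z\<close> is invertible because its determinant has constant term 1, so
  the definite description above is meaningful for it.\<close>

lemma matrix_inverse_pencil:
  fixes s m :: nat
  defines "n \<equiv> (s + 1) * m + 1"
  shows "matrix_inverse (pencil s m) \<in> carrier_mat n n"
    and "pencil s m * matrix_inverse (pencil s m) = 1\<^sub>m n"
    and "matrix_inverse (pencil s m) * pencil s m = 1\<^sub>m n"
proof -
  interpret nth0: comm_ring_hom "\<lambda>f :: real fps. fps_nth f 0"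
    by unfold_locales auto
  let ?A = "pencil s m"
  have Z: "mat_Z s m \<in> carrier_mat n n"
    unfolding mat_Z_def mat_X_def mat_Y_def n_def by auto
  then have A: "?A \<in> carrier_mat n n"
    unfolding pencil_def n_def by (auto simp del: mult_Suc)
  have "map_mat (\<lambda>f. fps_nth f 0) ?A = 1\<^sub>m n"
    using Z unfolding pencil_def n_def by (intro eq_matI) auto
  then have "fps_nth (det ?A) 0 = 1"
    using nth0.hom_det[of ?A] by simp
  then have u: "inverse (det ?A) * det ?A = 1"
    by (intro inverse_mult_eq_1) simp
  define B where "B = inverse (det ?A) \<cdot>\<^sub>m adj_mat ?A"
  have adj: "adj_mat ?A \<in> carrier_mat n n"
    "?A * adj_mat ?A = det ?A \<cdot>\<^sub>m 1\<^sub>m n" "adj_mat ?A * ?A = det ?A \<cdot>\<^sub>m 1\<^sub>m n"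
    using adj_mat[OF A] by auto
  have B: "B \<in> carrier_mat n n" unfolding B_def using adj by simp
  have "inverse (det ?A) \<cdot>\<^sub>m (det ?A \<cdot>\<^sub>m 1\<^sub>m n) = 1\<^sub>m n"
    by (rule eq_matI) (auto simp: u)
  moreover have "?A * B = inverse (det ?A) \<cdot>\<^sub>m (?A * adj_mat ?A)"
    unfolding B_def by (rule mult_smult_distrib[OF A adj(1)])
  moreover have "B * ?A = inverse (det ?A) \<cdot>\<^sub>m (adj_mat ?A * ?A)"
    unfolding B_def by (rule mult_smult_assoc_mat[OF adj(1) A])
  ultimately have AB: "?A * B = 1\<^sub>m n" and BA: "B * ?A = 1\<^sub>m n"
    using adj by simp_all
  then have "matrix_inverse ?A = B"
    using A B by (intro matrix_inverse_eqI[of _ n]) (auto simp: inverts_mat_def)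
  then show "matrix_inverse ?A \<in> carrier_mat n n"
    and "?A * matrix_inverse ?A = 1\<^sub>m n" and "matrix_inverse ?A * ?A = 1\<^sub>m n"
    using B AB BA by simp_all
qed

end

theory Submission
  imports Defs
begin

text \<open>
  Write \<open>z\<close> for the variable, \<open>N = (s + 1) m\<close>, and \<open>y\<close> for a row vector with \<open>y (I - z X Y) = c e\<^sup>T\<close>,
  where \<open>c\<close> is a scalar power series. Multiplying by the inverse on the right shows that
  \<open>c e\<^sup>T (I - z X Y)\<^sup>-\<^sup>1 b = y b\<close> for every \<open>b\<close>; hence \<open>c O\<close> is the sum of the entries of \<open>y\<close> and
  \<open>c E\<close> is the sum of the entries of \<open>y X\<close>. Two such row vectors prove the theorem.

  For the closed forms, the entries of \<open>X\<close> and \<open>Y\<close> are indicators of triangles, so taking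
  differences of consecutive components turns the linear system into a recursion with a delay,
  \<open>W (k + 1) = W k - z (W 0 + \<dots> + W (k - m))\<close>, which determines everything from \<open>W 0\<close>. With
  \<open>W 0 = 1\<close> its solution is \<open>W k = \<Sum>\<^sub>j (-z)\<^sup>j ((k + j - j m) choose 2 j)\<close>: since the index of
  summation shifts the delay into the upper entry of the binomial coefficient, the recursion is
  Pascal's rule together with the hockey-stick identity. The scalar \<open>c\<close> is then the next term
  \<open>W (N + 1)\<close> of the recursion, which is \<open>Delta\<close>. The sum of all \<open>W k\<close> with \<open>k \<le> N\<close> is, by the
  hockey-stick identity again, the numerator of \<open>O\<close>. Component \<open>0\<close> of the linear system reads
  \<open>1 = Delta + z Delta E\<close>, so \<open>Delta E = (1 - Delta) / z\<close>, the numerator of \<open>E\<close>.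

  For the identity about \<open>G\<close>, a lattice point of the dilated polytope is a walk
  \<open>x\<^sub>1, \<dots>, x\<^sub>d\<close> whose steps are allowed by \<open>X\<close> and \<open>Y\<close> alternately. The generating functions of
  the numbers of walks with an even number of steps that end in \<open>k\<close> form a row vector of the above
  kind with \<open>c = 1\<close>. So the coefficients of \<open>O\<close> and \<open>E\<close> count walks with an even and an odd number
  of steps. A walk without steps may start anywhere in \<open>{0..N}\<close>, while the
  one-dimensional count is by convention that of \<open>{0..s m}\<close>; this is the correction \<open>m\<close>.
\<close>

section \<open>Pairing with a solution of the transposed linear system\<close>

text \<open>The assumption says \<open>y (I - z X Y) = c e\<^sup>T\<close>, with the product \<open>y X Y\<close> written as
  two nested sums so that it can be matched with recursions. The conclusion is obtained by moving
  the pencil across the scalar product, where it cancels its inverse.\<close>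

lemma left_solution:
  fixes s m :: nat and y :: "nat \<Rightarrow> real fps" and c :: "real fps"
  defines "N \<equiv> (s + 1) * m"
  assumes y: "\<And>i. i \<le> N \<Longrightarrow>
    y i = c + fps_X * (\<Sum>l\<le>N. if l + i \<le> N then \<Sum>k\<le>N. if k + l \<le> s * m then y k else 0 else 0)"
  shows "c * series_O s m = (\<Sum>k\<le>N. y k)"
    and "c * series_E s m = (\<Sum>l\<le>N. \<Sum>k\<le>N. if k + l \<le> s * m then y k else 0)"
proof -
  let ?n = "N + 1"
  let ?M = "pencil s m" and ?B = "matrix_inverse (pencil s m)"
  let ?e = "map_vec fps_const (ones_vec s m)"
  have Z: "mat_Z s m \<in> carrier_mat ?n ?n"
    unfolding mat_Z_def mat_X_def mat_Y_def N_def by auto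
  then have M: "?M \<in> carrier_mat ?n ?n"
    unfolding pencil_def N_def by (auto simp del: mult_Suc)
  have B: "?B \<in> carrier_mat ?n ?n" and MB: "?M * ?B = 1\<^sub>m ?n"
    using matrix_inverse_pencil(1,2)[of s m] unfolding N_def by simp_all
  have e: "?e \<in> carrier_vec ?n" unfolding ones_vec_def N_def by simp
  define Y where "Y = vec ?n y"
  have Y: "Y \<in> carrier_vec ?n" unfolding Y_def by simp
  have Zki: "mat_Z s m $$ (k, i) =
      (\<Sum>l\<le>N. if k + l \<le> s * m \<and> l + i \<le> N then 1 else 0)" if "k \<le> N" "i \<le> N" for k i
  proof -
    have "mat_Z s m $$ (k, i) =
        (\<Sum>l = 0..<?n. (if k + l \<le> s * m then 1 else 0) * (if l + i \<le> N then 1 else 0))"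
      using that unfolding mat_Z_def mat_X_def mat_Y_def N_def
      by (simp add: scalar_prod_def del: mult_Suc)
    also have "\<dots> = (\<Sum>l\<le>N. if k + l \<le> s * m \<and> l + i \<le> N then 1 else 0)"
      by (rule sum.cong) auto
    finally show ?thesis .
  qed
  have eigen: "transpose_mat ?M *\<^sub>v Y = c \<cdot>\<^sub>v ?e"
  proof (rule eq_vecI)
    fix i assume "i < dim_vec (c \<cdot>\<^sub>v ?e)"
    then have i: "i \<le> N" unfolding ones_vec_def N_def by simp
    have "(transpose_mat ?M *\<^sub>v Y) $ i = (\<Sum>k = 0..<?n. ?M $$ (k, i) * y k)"
      using i M Y unfolding Y_def by (simp add: scalar_prod_def)
    also have "\<dots> = (\<Sum>k\<le>N. ?M $$ (k, i) * y k)"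
      by (rule sum.cong) auto
    also have "\<dots> = (\<Sum>k\<le>N. (if k = i then y k else 0)
        - fps_X * (fps_const (mat_Z s m $$ (k, i)) * y k))"
    proof (rule sum.cong[OF refl])
      fix k assume "k \<in> {..N}"
      then show "?M $$ (k, i) * y k = (if k = i then y k else 0)
          - fps_X * (fps_const (mat_Z s m $$ (k, i)) * y k)"
        using i Z unfolding pencil_def N_def by (simp add: algebra_simps del: mult_Suc)
    qed
    also have "\<dots> = y i - fps_X * (\<Sum>k\<le>N. fps_const (mat_Z s m $$ (k, i)) * y k)"
      using i by (simp add: sum_subtractf sum_distrib_left)
    also have "(\<Sum>k\<le>N. fps_const (mat_Z s m $$ (k, i)) * y k) =
        (\<Sum>k\<le>N. \<Sum>l\<le>N. if k + l \<le> s * m \<and> l + i \<le> N then y k else 0)"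
    proof (rule sum.cong[OF refl])
      fix k assume "k \<in> {..N}"
      then have "fps_const (mat_Z s m $$ (k, i)) =
          (\<Sum>l\<le>N. if k + l \<le> s * m \<and> l + i \<le> N then 1 else 0)"
        using i by (intro fps_ext) (simp add: Zki fps_sum_nth if_distrib[of "\<lambda>t. fps_nth t _"] cong: if_cong)
      then show "fps_const (mat_Z s m $$ (k, i)) * y k =
          (\<Sum>l\<le>N. if k + l \<le> s * m \<and> l + i \<le> N then y k else 0)"
        by (simp add: sum_distrib_right if_distrib[of "\<lambda>t. t * y k"] cong: if_cong)
    qed
    also have "\<dots> = (\<Sum>l\<le>N. if l + i \<le> N then \<Sum>k\<le>N. if k + l \<le> s * m then y k else 0 else 0)"
      by (subst sum.swap, rule sum.cong) auto
    also have "y i - fps_X * \<dots> = c" using y[OF i] by simp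
    finally show "(transpose_mat ?M *\<^sub>v Y) $ i = (c \<cdot>\<^sub>v ?e) $ i"
      using i unfolding ones_vec_def N_def by simp
  qed (use M in \<open>auto simp: ones_vec_def N_def\<close>)
  have pair: "c * (?e \<bullet> (?B *\<^sub>v b)) = (\<Sum>k\<le>N. y k * b $ k)" if b: "b \<in> carrier_vec ?n" for b
  proof -
    have Bb: "?B *\<^sub>v b \<in> carrier_vec ?n" using B b by simp
    have "c * (?e \<bullet> (?B *\<^sub>v b)) = (transpose_mat ?M *\<^sub>v Y) \<bullet> (?B *\<^sub>v b)"
      unfolding eigen using e Bb by (simp add: smult_scalar_prod_distrib)
    also have "\<dots> = Y \<bullet> (?M *\<^sub>v (?B *\<^sub>v b))"
      by (rule transpose_vec_mult_scalar[OF M Bb Y])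
    also have "?M *\<^sub>v (?B *\<^sub>v b) = b"
      using M B b MB by (simp flip: assoc_mult_mat_vec)
    also have "Y \<bullet> b = (\<Sum>k = 0..<?n. y k * b $ k)"
      using b unfolding Y_def scalar_prod_def by simp
    also have "\<dots> = (\<Sum>k\<le>N. y k * b $ k)" by (rule sum.cong) auto
    finally show ?thesis .
  qed
  show "c * series_O s m = (\<Sum>k\<le>N. y k)"
    unfolding series_O_def pair[OF e] by (rule sum.cong) (auto simp: ones_vec_def N_def)
  let ?Xe = "map_mat fps_const (mat_X s m) *\<^sub>v ?e"
  have "mat_X s m \<in> carrier_mat ?n ?n" unfolding mat_X_def N_def by auto
  then have Xe: "?Xe \<in> carrier_vec ?n"
    using e by (intro mult_mat_vec_carrier[of _ _ ?n]) simp_all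
  have "y k * ?Xe $ k = (\<Sum>l\<le>N. if k + l \<le> s * m then y k else 0)" if "k \<le> N" for k
  proof -
    have "?Xe $ k = (\<Sum>l = 0..<?n. if k + l \<le> s * m then 1 else 0)"
      using that unfolding mat_X_def ones_vec_def N_def
      by (simp add: scalar_prod_def if_distrib[of fps_const] del: mult_Suc cong: if_cong)
    also have "\<dots> = (\<Sum>l\<le>N. if k + l \<le> s * m then 1 else 0)" by (rule sum.cong) auto
    finally show ?thesis
      by (simp add: sum_distrib_left if_distrib[of "\<lambda>t. y k * t"] cong: if_cong)
  qed
  then have "c * series_E s m = (\<Sum>k\<le>N. \<Sum>l\<le>N. if k + l \<le> s * m then y k else 0)"
    unfolding series_E_def pair[OF Xe] by (intro sum.cong) auto
  then show "c * series_E s m = (\<Sum>l\<le>N. \<Sum>k\<le>N. if k + l \<le> s * m then y k else 0)"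
    by (subst sum.swap)
qed

section \<open>The delayed recursion\<close>

text \<open>The solution \<open>W k\<close> of the delayed recursion in closed form, with \<open>m\<close> the delay.\<close>

definition delay_series :: "nat \<Rightarrow> nat \<Rightarrow> real fps" where
  "delay_series m k = Abs_fps (\<lambda>j. (- 1) ^ j * real ((k + j - j * m) choose (2 * j)))"

lemma fps_nth_delay_series:
  "fps_nth (delay_series m k) j = (- 1) ^ j * real ((k + j - j * m) choose (2 * j))"
  by (simp add: delay_series_def)

text \<open>Where \<open>i + j \<ge> j m\<close> the step from \<open>K\<close> to \<open>K + 1\<close> is Pascal's rule. Where the subtraction
  is truncated, \<open>j > 0\<close> and the upper entries are too small for a nonzero term on either side.\<close>

lemma delayed_hockey_stick:
  fixes m j K :: nat
  shows "(\<Sum>i<K. (i + j - j * m) choose (2 * j)) = (K + j - j * m) choose (2 * j + 1)"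
proof (induction K)
  case 0
  show ?case by simp
next
  case (Suc K)
  show ?case
  proof (cases "j * m \<le> K + j")
    case True
    then have "Suc K + j - j * m = Suc (K + j - j * m)" by simp
    then show ?thesis using Suc by (simp add: add.commute)
  next
    case False
    then have "j > 0" by (cases j) auto
    then show ?thesis using Suc False by simp
  qed
qed

lemma fps_nth_sum_delay_series:
  "fps_nth (\<Sum>i<K. delay_series m i) j = (- 1) ^ j * real ((K + j - j * m) choose (2 * j + 1))"
  unfolding delayed_hockey_stick[symmetric]
  by (simp add: fps_sum_nth delay_series_def sum_distrib_left)

text \<open>Raising the power of \<open>z\<close> from \<open>i\<close> to \<open>i + 1\<close> moves the upper entry of the binomial coefficient
  by \<open>1 - m\<close>, which is the delay in the sum. Coefficientwise the recursion is therefore Pascal's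
  rule, with the sum evaluated by the hockey-stick identity.\<close>

lemma delay_series_Suc:
  "delay_series m (Suc k) = delay_series m k - fps_X * (\<Sum>i<Suc k - m. delay_series m i)"
proof (rule fps_ext)
  fix j
  show "fps_nth (delay_series m (Suc k)) j =
    fps_nth (delay_series m k - fps_X * (\<Sum>i<Suc k - m. delay_series m i)) j"
  proof (cases j)
    case 0
    then show ?thesis by (simp add: delay_series_def)
  next
    case (Suc i)
    have "(Suc k + j - j * m) choose (2 * j) =
        ((k + j - j * m) choose (2 * j)) + ((Suc k - m + i - i * m) choose (2 * i + 1))"
    proof (cases "j * m \<le> k + j")
      case True
      have "m \<le> Suc k"
      proof (rule ccontr)
        assume "\<not> m \<le> Suc k"
        then have "m \<ge> k + 2" by simp
        then have "i * m \<ge> i" by simp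
        with \<open>m \<ge> k + 2\<close> True Suc show False by simp
      qed
      with True Suc have "Suc k + j - j * m = Suc (k + j - j * m)"
        and "Suc k - m + i - i * m = k + j - j * m" by simp_all
      then show ?thesis using Suc by simp
    next
      case False
      have "Suc k - m + i - i * m = 0"
      proof (cases "m \<le> Suc k")
        case False
        then have "i * m \<ge> i" by simp
        with False show ?thesis by simp
      qed (use False Suc in simp)
      with False Suc show ?thesis by simp
    qed
    then show ?thesis using Suc
      by (simp add: fps_nth_sum_delay_series fps_nth_delay_series algebra_simps del: sum.lessThan_Suc)
  qed
qed

lemma delay_series_0: "delay_series m 0 = 1"
proof (rule fps_ext)
  fix j :: nat
  have "j - j * m < 2 * j" if "j > 0" using that by linarith
  then show "fps_nth (delay_series m 0) j = fps_nth 1 j"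
    by (simp add: delay_series_def)
qed

lemma fps_nth_sum_monomials:
  "fps_nth (\<Sum>j = 0..n. fps_const (c j) * fps_X ^ j) i = (if i \<le> n then c i else (0::real))"
  by (simp add: fps_sum_nth if_distrib[of "\<lambda>t. c _ * t"] cong: if_cong)

lemma polynomial_eq_fps:
  fixes c :: "nat \<Rightarrow> real"
  assumes "\<And>j. j \<le> n \<Longrightarrow> fps_nth f j = c j" "\<And>j. j > n \<Longrightarrow> fps_nth f j = 0"
  shows "f = (\<Sum>j = 0..n. fps_const (c j) * fps_X ^ j)"
  using assms by (intro fps_ext) (simp add: fps_nth_sum_monomials)

lemma top_index:
  fixes s m j :: nat
  assumes "j \<le> s"
  shows "Suc ((s + 1) * m) + j - j * m = (s + 1 - j) * m + j + 1"
proof -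
  have "(s + 1 - j) * m + j * m = (s + 1) * m"
    using assms by (simp flip: add_mult_distrib)
  then show ?thesis by simp
qed

lemma top_index_bound:
  fixes s m j :: nat
  assumes "j > s"
  shows "Suc ((s + 1) * m) + j - j * m \<le> j + 1"
proof -
  have "(s + 1) * m \<le> j * m" using assms by (intro mult_right_mono) auto
  then show ?thesis by simp
qed

text \<open>Beyond degree \<open>s\<close> the upper entry of the binomial coefficient is at most \<open>j + 1\<close>, which is
  less than \<open>2 j\<close> once \<open>j \<ge> 2\<close>. For \<open>s = 0\<close> a further term \<open>2 choose 2\<close> in degree \<open>1\<close> survives.\<close>

lemma delay_series_top:
  assumes "s \<ge> 1"
  shows "delay_series m (Suc ((s + 1) * m)) = Delta s m"
  unfolding Delta_def coeff_a_def
proof (rule polynomial_eq_fps)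
  fix j assume "j > s"
  then have "Suc ((s + 1) * m) + j - j * m < 2 * j"
    using top_index_bound[of s j m] assms by linarith
  then show "fps_nth (delay_series m (Suc ((s + 1) * m))) j = 0"
    by (simp add: delay_series_def binomial_eq_0 del: mult_Suc)
qed (use top_index in \<open>simp add: delay_series_def del: mult_Suc\<close>)

lemma sum_delay_series_top:
  "(\<Sum>k\<le>(s + 1) * m. delay_series m k) =
    (\<Sum>j = 0..s. fps_const ((- 1) ^ j * real (coeff_b s m j)) * fps_X ^ j)"
  unfolding lessThan_Suc_atMost[symmetric] coeff_b_def
proof (rule polynomial_eq_fps)
  fix j assume "j > s"
  then have "Suc ((s + 1) * m) + j - j * m < 2 * j + 1"
    using top_index_bound[of s j m] by linarith
  then show "fps_nth (\<Sum>k<Suc ((s + 1) * m). delay_series m k) j = 0"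
    by (subst fps_nth_sum_delay_series) (simp add: binomial_eq_0 del: mult_Suc)
qed (use top_index in \<open>simp add: fps_nth_sum_delay_series del: mult_Suc sum.lessThan_Suc\<close>)

text \<open>Component \<open>l\<close> of \<open>W X\<close> is the partial sum of \<open>W\<close> that the recursion at \<open>k = N - l\<close>
  subtracts, since \<open>s m - l = k - m\<close>. Multiplication by \<open>Y\<close> adds up these differences, and the sum
  telescopes from \<open>W i\<close> to \<open>W (N + 1)\<close>, which is \<open>Delta\<close>.\<close>

lemma delay_series_left_solution:
  fixes s m i :: nat
  defines "N \<equiv> (s + 1) * m"
  assumes s: "s \<ge> 1" and i: "i \<le> N"
  shows "delay_series m i = Delta s m + fps_X * (\<Sum>l\<le>N. if l + i \<le> N
    then \<Sum>k\<le>N. if k + l \<le> s * m then delay_series m k else 0 else 0)"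
proof -
  let ?W = "delay_series m"
  have step: "fps_X * (\<Sum>k\<le>N. if k + l \<le> s * m then ?W k else 0) = ?W (N - l) - ?W (Suc (N - l))"
    if "l \<le> N" for l
  proof -
    have "(\<Sum>k\<le>N. if k + l \<le> s * m then ?W k else 0) = (\<Sum>k | k \<le> N \<and> k + l \<le> s * m. ?W k)"
      by (simp add: sum.If_cases Int_def)
    also have "{k. k \<le> N \<and> k + l \<le> s * m} = {..<Suc (N - l) - m}"
      using that unfolding N_def by auto
    finally show ?thesis using delay_series_Suc[of m "N - l"] by simp
  qed
  have "fps_X * (\<Sum>l\<le>N. if l + i \<le> N then \<Sum>k\<le>N. if k + l \<le> s * m then ?W k else 0 else 0)
      = (\<Sum>l\<le>N. if l + i \<le> N then ?W (N - l) - ?W (Suc (N - l)) else 0)"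
    unfolding sum_distrib_left by (rule sum.cong) (auto simp: step)
  also have "\<dots> = (\<Sum>l\<le>N - i. ?W (N - l) - ?W (Suc (N - l)))"
    using i by (intro sum.mono_neutral_cong_right) auto
  also have "\<dots> = (\<Sum>l\<le>N - i. ?W (Suc N - Suc l) - ?W (Suc N - l))"
    by (rule sum.cong) (auto simp: Suc_diff_le)
  also have "\<dots> = ?W (Suc N - Suc (N - i)) - ?W (Suc N)"
    by (subst lessThan_Suc_atMost[symmetric], subst sum_lessThan_telescope) simp
  also have "\<dots> = ?W i - Delta s m"
    using i delay_series_top[OF s, of m] unfolding N_def by (simp del: mult_Suc)
  finally show ?thesis by simp
qed


section \<open>Lattice points as walks\<close>

text \<open>The \<open>i\<close>-th step of a walk, from coordinate \<open>i\<close> to coordinate \<open>i + 1\<close>, is counted from \<open>1\<close>,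
  so the odd steps are those of \<open>X\<close> and the even ones those of \<open>Y\<close>.\<close>

definition walk_bound :: "nat \<Rightarrow> nat \<Rightarrow> nat \<Rightarrow> nat" where
  "walk_bound s m i = (s + delta i) * m"

primrec walk_count :: "nat \<Rightarrow> nat \<Rightarrow> nat \<Rightarrow> nat \<Rightarrow> nat" where
  "walk_count s m 0 j = 1"
| "walk_count s m (Suc d) j =
     (\<Sum>i\<le>(s + 1) * m. if i + j \<le> walk_bound s m (Suc d) then walk_count s m d i else 0)"

definition walks :: "nat \<Rightarrow> nat \<Rightarrow> nat \<Rightarrow> nat list set" where
  "walks s m d = {xs. length xs = Suc d \<and> set xs \<subseteq> {..(s + 1) * m} \<and>
     (\<forall>i<d. xs ! i + xs ! Suc i \<le> walk_bound s m (Suc i))}"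

lemma finite_walks: "finite (walks s m d)"
  by (rule finite_subset[OF _ finite_lists_length_eq[of "{..(s + 1) * m}" "Suc d"]])
    (auto simp: walks_def)

text \<open>Walks are extended at the end and not at the beginning, since the bound of a step depends on
  its distance from the start.\<close>

lemma walks_Suc_last:
  assumes "j \<le> (s + 1) * m"
  shows "{xs \<in> walks s m (Suc d). last xs = j} = (\<lambda>xs. xs @ [j]) `
    (\<Union>i\<in>{i. i \<le> (s + 1) * m \<and> i + j \<le> walk_bound s m (Suc d)}. {xs \<in> walks s m d. last xs = i})"
    (is "?L = ?R")
proof (intro equalityI subsetI)
  fix ys assume ys: "ys \<in> ?L"
  then obtain xs where xs: "ys = xs @ [j]" "length xs = Suc d"
    unfolding walks_def by (cases ys rule: rev_cases) auto
  from xs have last: "last xs = xs ! d" by (subst last_conv_nth) auto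
  have adj: "ys ! i + ys ! Suc i \<le> walk_bound s m (Suc i)" if "i < Suc d" for i
    using ys that unfolding walks_def by auto
  have "xs ! i + xs ! Suc i \<le> walk_bound s m (Suc i)" if "i < d" for i
    using adj[of i] that xs by (simp add: nth_append)
  moreover have "last xs + j \<le> walk_bound s m (Suc d)"
    using adj[of d] xs last by (simp add: nth_append)
  moreover have "set xs \<subseteq> {..(s + 1) * m}" using ys xs unfolding walks_def by auto
  moreover have "last xs \<in> set xs" using xs by (intro last_in_set) auto
  ultimately show "ys \<in> ?R" using xs unfolding walks_def by auto
next
  fix ys assume "ys \<in> ?R"
  then obtain xs where xs: "ys = xs @ [j]" "xs \<in> walks s m d"
    and bound: "last xs + j \<le> walk_bound s m (Suc d)" by auto
  from xs have len: "length xs = Suc d" unfolding walks_def by simp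
  then have last: "last xs = xs ! d" by (subst last_conv_nth) auto
  have "ys ! i + ys ! Suc i \<le> walk_bound s m (Suc i)" if "i < Suc d" for i
    using that xs bound len last unfolding walks_def
    by (cases "i = d") (auto simp: nth_append)
  then show "ys \<in> ?L" using xs assms unfolding walks_def by auto
qed

lemma card_walks_last:
  assumes "j \<le> (s + 1) * m"
  shows "card {xs \<in> walks s m d. last xs = j} = walk_count s m d j"
  using assms
proof (induction d arbitrary: j)
  case 0
  then have "{xs \<in> walks s m 0. last xs = j} = {[j]}"
    unfolding walks_def by (auto simp: length_Suc_conv)
  then show ?case by simp
next
  case (Suc d)
  let ?I = "{i. i \<le> (s + 1) * m \<and> i + j \<le> walk_bound s m (Suc d)}"
  have "card {xs \<in> walks s m (Suc d). last xs = j} =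
      card (\<Union>i\<in>?I. {xs \<in> walks s m d. last xs = i})"
    unfolding walks_Suc_last[OF Suc.prems] by (rule card_image) (simp add: inj_on_def)
  also have "\<dots> = (\<Sum>i\<in>?I. card {xs \<in> walks s m d. last xs = i})"
    using finite_walks by (intro card_UN_disjoint) auto
  also have "\<dots> = (\<Sum>i\<in>?I. walk_count s m d i)"
    using Suc.IH by (intro sum.cong) auto
  also have "\<dots> = walk_count s m (Suc d) j"
    unfolding walk_count.simps by (intro sum.mono_neutral_cong_left) auto
  finally show ?case .
qed

lemma card_walks: "card (walks s m d) = (\<Sum>j\<le>(s + 1) * m. walk_count s m d j)"
proof -
  have "last xs \<in> {..(s + 1) * m}" if "xs \<in> walks s m d" for xs
  proof -
    have "last xs \<in> set xs" using that unfolding walks_def by (intro last_in_set) auto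
    then show ?thesis using that unfolding walks_def by auto
  qed
  then have "walks s m d = (\<Union>j\<le>(s + 1) * m. {xs \<in> walks s m d. last xs = j})" by auto
  then have "card (walks s m d) = card (\<Union>j\<le>(s + 1) * m. {xs \<in> walks s m d. last xs = j})"
    by (rule arg_cong)
  also have "\<dots> = (\<Sum>j\<le>(s + 1) * m. card {xs \<in> walks s m d. last xs = j})"
    using finite_walks by (intro card_UN_disjoint) auto
  finally show ?thesis using card_walks_last by simp
qed

text \<open>With at least one step every coordinate takes part in some constraint, which bounds it by
  \<open>(s + 1) m\<close>; so the range imposed on walks loses no lattice point. In dimension one this fails,
  as the polytope is then an unbounded ray.\<close>

lemma dilated_lattice_points:
  assumes m: "m \<ge> 1" and d: "d \<ge> 1"
  shows "(\<lambda>x. real m \<cdot>\<^sub>v x) ` polytope_P s (Suc d) \<inter> integer_points (Suc d) =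
    (\<lambda>xs. vec (Suc d) (\<lambda>i. real (xs ! i))) ` walks s m d" (is "?L = ?f ` _")
proof (intro equalityI subsetI)
  fix z assume z: "z \<in> ?L"
  then obtain x where x: "x \<in> polytope_P s (Suc d)" and zx: "z = real m \<cdot>\<^sub>v x" by auto
  have dim: "dim_vec z = Suc d" "dim_vec x = Suc d"
    using z x unfolding integer_points_def polytope_P_def by auto
  have x0: "0 \<le> x $ i" if "i \<le> d" for i
  proof -
    have "Suc i \<in> {1..Suc d}" using that by simp
    then have "0 \<le> x $ (Suc i - 1)" using x unfolding polytope_P_def by blast
    then show ?thesis by simp
  qed
  have x1: "x $ i + x $ Suc i \<le> real (s + delta (Suc i))" if "i < d" for i
  proof -
    have "Suc i \<in> {1..Suc d - 1}" using that by simp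
    then have "x $ (Suc i - 1) + x $ Suc i \<le> real (s + delta (Suc i))"
      using x unfolding polytope_P_def by blast
    then show ?thesis by simp
  qed
  have "\<exists>a::nat. z $ i = real a" if "i \<le> d" for i
  proof -
    have "z $ i \<in> \<int>" using z that unfolding integer_points_def by auto
    moreover have "z $ i \<ge> 0" using x0[OF that] that dim zx by simp
    ultimately show ?thesis by (metis Ints_cases of_int_0_le_iff of_int_of_nat_eq zero_le_imp_eq_int)
  qed
  then obtain a :: "nat \<Rightarrow> nat" where a: "\<And>i. i \<le> d \<Longrightarrow> z $ i = real (a i)" by metis
  have adj: "a i + a (Suc i) \<le> walk_bound s m (Suc i)" if "i < d" for i
  proof -
    have "real (a i) + real (a (Suc i)) = real m * (x $ i + x $ Suc i)"
      using a[of i] a[of "Suc i"] that dim zx by (simp add: algebra_simps)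
    also have "\<dots> \<le> real m * real (s + delta (Suc i))"
      using x1[OF that] by (intro mult_left_mono) auto
    finally have "real (a i + a (Suc i)) \<le> real (walk_bound s m (Suc i))"
      unfolding walk_bound_def by (simp add: algebra_simps)
    then show ?thesis by linarith
  qed
  have bound: "walk_bound s m i \<le> (s + 1) * m" for i
    unfolding walk_bound_def delta_def by simp
  have "a i \<le> (s + 1) * m" if "i \<le> d" for i
  proof (cases "i < d")
    case True
    then show ?thesis using adj[of i] bound[of "Suc i"] by linarith
  next
    case False
    obtain d' where "d = Suc d'" using d by (cases d) auto
    with that False have "i = Suc d'" "d' < d" by auto
    then show ?thesis using adj[of d'] bound[of "Suc d'"] by auto
  qed
  then have "map a [0..<Suc d] \<in> walks s m d"
    using adj unfolding walks_def by (auto simp del: upt_Suc)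
  moreover have "z = ?f (map a [0..<Suc d])"
    using dim a by (intro eq_vecI) (auto simp del: upt_Suc)
  ultimately show "z \<in> ?f ` walks s m d" by blast
next
  fix z assume "z \<in> ?f ` walks s m d"
  then obtain xs where xs: "xs \<in> walks s m d" and z: "z = ?f xs" by auto
  define x where "x = vec (Suc d) (\<lambda>i. real (xs ! i) / real m)"
  have "x \<in> polytope_P s (Suc d)"
    unfolding polytope_P_def
  proof (intro CollectI conjI ballI)
    fix i assume "i \<in> {1..Suc d - 1}"
    then obtain i' where i: "i = Suc i'" "i' < d" by (cases i) auto
    then have "xs ! i' + xs ! i \<le> (s + delta i) * m"
      using xs unfolding walks_def walk_bound_def by auto
    then have "real (xs ! i' + xs ! i) \<le> real ((s + delta i) * m)" by linarith
    then show "x $ (i - 1) + x $ i \<le> real (s + delta i)"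
      using i m unfolding x_def by (simp add: divide_simps algebra_simps)
  qed (auto simp: x_def)
  moreover have "z = real m \<cdot>\<^sub>v x"
    using m unfolding z x_def by (intro eq_vecI) auto
  moreover have "z \<in> integer_points (Suc d)"
    unfolding z integer_points_def by auto
  ultimately show "z \<in> ?L" by blast
qed

lemma lattice_count_eq_walk_count:
  assumes m: "m \<ge> 1" and d: "d \<ge> 1"
  shows "lattice_count s (Suc d) m = (\<Sum>j\<le>(s + 1) * m. walk_count s m d j)"
proof -
  have "inj_on (\<lambda>xs. vec (Suc d) (\<lambda>i. real (xs ! i))) (walks s m d)"
  proof (rule inj_onI)
    fix xs ys assume len: "xs \<in> walks s m d" "ys \<in> walks s m d"
      and eq: "vec (Suc d) (\<lambda>i. real (xs ! i)) = vec (Suc d) (\<lambda>i. real (ys ! i))"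
    have "xs ! i = ys ! i" if "i < Suc d" for i
      using arg_cong[OF eq, of "\<lambda>v. v $ i"] that by simp
    then show "xs = ys" using len unfolding walks_def by (intro nth_equalityI) auto
  qed
  then show ?thesis
    using d unfolding lattice_count_def dilated_lattice_points[OF assms]
    by (simp add: card_image card_walks)
qed

lemma walk_count_two_steps:
  "walk_count s m (Suc (2 * r)) l =
     (\<Sum>k\<le>(s + 1) * m. if k + l \<le> s * m then walk_count s m (2 * r) k else 0)"
  "walk_count s m (Suc (Suc (2 * r))) i =
     (\<Sum>l\<le>(s + 1) * m. if l + i \<le> (s + 1) * m then walk_count s m (Suc (2 * r)) l else 0)"
  by (simp_all add: walk_bound_def delta_def cong: if_cong)

section \<open>Coefficients of the parity-split series\<close>

text \<open>The recursion for two consecutive steps is the coefficientwise form of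
  \<open>y (I - z X Y) = e\<^sup>T\<close>, where \<open>y\<close> collects the walks with an even number of steps, and \<open>q = y X\<close>
  collects those with an odd number.\<close>

lemma fps_nth_series_walk_count:
  "fps_nth (series_O s m) r = real (\<Sum>j\<le>(s + 1) * m. walk_count s m (2 * r) j)" (is ?O)
  "fps_nth (series_E s m) r = real (\<Sum>j\<le>(s + 1) * m. walk_count s m (Suc (2 * r)) j)" (is ?E)
proof -
  let ?N = "(s + 1) * m"
  define y where "y i = Abs_fps (\<lambda>r. real (walk_count s m (2 * r) i))" for i
  define q where "q l = (\<Sum>k\<le>?N. if k + l \<le> s * m then y k else 0)" for l
  have nth: "fps_nth (q l) r = real (walk_count s m (Suc (2 * r)) l)" for l r
    unfolding walk_count_two_steps(1) q_def y_def
    by (simp add: fps_sum_nth if_distrib[of "\<lambda>t. fps_nth t _"] if_distrib[of real]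
        del: walk_count.simps cong: if_cong)
  have y: "y i = 1 + fps_X * (\<Sum>l\<le>?N. if l + i \<le> ?N then q l else 0)" for i
  proof (rule fps_ext)
    fix r
    show "fps_nth (y i) r = fps_nth (1 + fps_X * (\<Sum>l\<le>?N. if l + i \<le> ?N then q l else 0)) r"
    proof (cases r)
      case (Suc r')
      have "fps_nth (y i) r = real (walk_count s m (Suc (Suc (2 * r'))) i)"
        by (simp only: y_def fps_nth_Abs_fps Suc mult_Suc_right add_2_eq_Suc)
      then show ?thesis
        unfolding walk_count_two_steps(2) using Suc
        by (simp add: fps_sum_nth if_distrib[of "\<lambda>t. fps_nth t _"] if_distrib[of real] nth
            del: walk_count.simps cong: if_cong)
    qed (simp add: y_def)
  qed
  have "series_O s m = (\<Sum>k\<le>?N. y k)"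
    using left_solution(1)[where c = 1 and y = y and s = s and m = m] y unfolding q_def by auto
  then show ?O by (simp add: fps_sum_nth y_def)
  have "series_E s m = (\<Sum>l\<le>?N. q l)"
    using left_solution(2)[where c = 1 and y = y and s = s and m = m] y unfolding q_def by auto
  then show ?E by (simp add: fps_sum_nth nth del: walk_count.simps)
qed

lemma fps_nth_compose_X_squared:
  "fps_nth (fps_compose f (fps_X ^ 2)) n = (if even n then fps_nth f (n div 2) else (0::real))"
proof -
  have "fps_nth (fps_compose f (fps_X ^ 2)) n =
      (\<Sum>i = 0..n. if n = 2 * i then fps_nth f i else 0)"
    unfolding fps_compose_nth
    by (rule sum.cong) (auto simp flip: power_mult)
  also have "\<dots> = (\<Sum>i = 0..n. if even n \<and> i = n div 2 then fps_nth f i else 0)"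
    by (rule sum.cong) auto
  finally show ?thesis by (auto simp: sum.If_cases)
qed

lemma series_G_parity_split:
  assumes m: "m \<ge> 1"
  shows "series_G s m =
    1 + fps_X * (fps_compose (series_O s m) (fps_X ^ 2) - of_nat m)
      + fps_X ^ 2 * fps_compose (series_E s m) (fps_X ^ 2)" (is "_ = ?R")
proof (rule fps_ext)
  fix d
  have O0: "fps_nth (series_O s m) 0 = real ((s + 1) * m + 1)"
    by (simp add: fps_nth_series_walk_count)
  consider "d = 0" | "d = 1" | r where "d = Suc (2 * Suc r)" | r where "d = Suc (Suc (2 * r))"
  proof -
    consider r where "d = 2 * r" | r where "d = Suc (2 * r)" by (metis oddE evenE Suc_eq_plus1)
    then show ?thesis using that
      by cases (metis not0_implies_Suc mult_0_right mult_Suc_right add_2_eq_Suc One_nat_def)+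
  qed
  then show "fps_nth (series_G s m) d = fps_nth ?R d"
  proof cases
    case 1
    then show ?thesis by (simp add: series_G_def lattice_count_def)
  next
    case 2
    then show ?thesis
      by (simp add: series_G_def lattice_count_def O0 fps_nth_compose_X_squared fps_X_power_mult_nth
          algebra_simps)
  next
    case (3 r)
    have "fps_nth (series_G s m) d = fps_nth (series_O s m) (Suc r)"
      using lattice_count_eq_walk_count[OF m, of "2 * Suc r" s] 3
      by (simp add: series_G_def fps_nth_series_walk_count del: walk_count.simps)
    then show ?thesis
      using 3 by (simp add: fps_nth_compose_X_squared fps_X_power_mult_nth fps_nth_of_nat)
  next
    case (4 r)
    have "fps_nth (series_G s m) d = fps_nth (series_E s m) r"
      using lattice_count_eq_walk_count[OF m, of "Suc (2 * r)" s] 4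
      by (simp add: series_G_def fps_nth_series_walk_count del: walk_count.simps)
    then show ?thesis
      using 4 by (simp add: fps_nth_compose_X_squared fps_X_power_mult_nth fps_nth_of_nat)
  qed
qed

lemma X_times_numerator_E:
  assumes "s \<ge> 1"
  shows "fps_X * (\<Sum>j = 0..s - 1. fps_const ((- 1) ^ j * real (coeff_a s m (j + 1))) * fps_X ^ j)
    = 1 - Delta s m"
proof (rule fps_ext)
  fix j
  show "fps_nth (fps_X * (\<Sum>j = 0..s - 1. fps_const ((- 1) ^ j * real (coeff_a s m (j + 1))) * fps_X ^ j)) j
    = fps_nth (1 - Delta s m) j"
    using assms unfolding Delta_def
    by (cases j) (auto simp: fps_nth_sum_monomials coeff_a_def)
qed

section \<open>Closed forms and parity split\<close>

theorem theorem1p8: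
  fixes s m :: nat
  assumes "s \<ge> 1" and "m \<ge> 1"
  shows "series_E s m =
           (\<Sum>j = 0..s - 1. fps_const ((- 1) ^ j * real (coeff_a s m (j + 1))) * fps_X ^ j)
             / Delta s m
       \<and> series_O s m =
           (\<Sum>j = 0..s. fps_const ((- 1) ^ j * real (coeff_b s m j)) * fps_X ^ j)
             / Delta s m
       \<and> series_G s m =
           1 + fps_X * (fps_compose (series_O s m) (fps_X ^ 2) - of_nat m)
             + fps_X ^ 2 * fps_compose (series_E s m) (fps_X ^ 2)"
proof (intro conjI)
  let ?N = "(s + 1) * m"
  let ?a = "\<Sum>j = 0..s - 1. fps_const ((- 1) ^ j * real (coeff_a s m (j + 1))) * fps_X ^ j"
  let ?b = "\<Sum>j = 0..s. fps_const ((- 1) ^ j * real (coeff_b s m j)) * fps_X ^ j"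
  note W = delay_series_left_solution[OF assms(1), of _ m]
  have "fps_nth (Delta s m) 0 = 1"
    unfolding Delta_def by (simp add: fps_nth_sum_monomials coeff_a_def)
  then have nz: "Delta s m \<noteq> 0" by auto
  have "Delta s m * series_O s m = ?b"
    using left_solution(1)[OF W] sum_delay_series_top[of m s] by simp
  then show "series_O s m = ?b / Delta s m"
    using nz by (metis nonzero_mult_div_cancel_left)
  have E: "Delta s m * series_E s m = (\<Sum>l\<le>?N. \<Sum>k\<le>?N. if k + l \<le> s * m then delay_series m k else 0)"
    by (rule left_solution(2)[OF W])
  \<comment> \<open>Every entry of column \<open>0\<close> of \<open>Y\<close> is \<open>1\<close>, so component \<open>0\<close> of the linear system
    already contains the sum that computes \<open>E\<close>.\<close>
  have "delay_series m 0 = Delta s m + fps_X *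
      (\<Sum>l\<le>?N. \<Sum>k\<le>?N. if k + l \<le> s * m then delay_series m k else 0)"
    using W[of 0] by simp
  then have "1 = Delta s m + fps_X * (Delta s m * series_E s m)"
    unfolding E delay_series_0 .
  then have "fps_X * (Delta s m * series_E s m) = 1 - Delta s m"
    by (metis add_diff_cancel_left')
  then have "fps_X * (Delta s m * series_E s m) = fps_X * ?a"
    unfolding X_times_numerator_E[OF assms(1), of m] .
  then have "Delta s m * series_E s m = ?a"
    using mult_left_cancel[OF fps_X_neq_zero] by blast
  then show "series_E s m = ?a / Delta s m"
    using nz by (metis nonzero_mult_div_cancel_left)
  show "series_G s m =
           1 + fps_X * (fps_compose (series_O s m) (fps_X ^ 2) - of_nat m)
             + fps_X ^ 2 * fps_compose (series_E s m) (fps_X ^ 2)"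
    by (rule series_G_parity_split[OF assms(2)])
qed

end
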